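(* Let $\{x_k\}$ be generated by the three-step algorithm $x_{k+1/3}=\mathcal O_{f_0}(\lambda_k,x_k)$, $x_{k+2/3}=\mathcal O_{f_1}(\mu_k,x_{k+1/3})$, $x_{k+1}=\mathcal P_{X_0}(x_{k+2/3})$, $k=0,1,2,\dots$, from a starting point $x_0\in\mathbb R^n$. Assume that: (i) $X_2\neq\emptyset$, and $X_2$ is bounded (or $\{x_k\}$ is bounded); (ii) $\mu_k\to0$ and $\sum_{k=0}^\infty\mu_k=\infty$; (iii) $\mathcal O_{f_0}$ and $\mathcal O_{f_1}$ satisfy Property 1 (with error terms $\rho_0$, $\rho_1$), and $\mathcal O_{f_1}$ also satisfies Property 2 (both properties are given in the context); (iv) $\lambda_k[f_0^*-f_0(x_{k+1/3})]_+/\mu_k\to0$; (v) $d_{X_1}(x_k)\to0$ and $\|x_k-x_{k+1/3}\|\to0$; (vi) $\lambda_k\rho_0(\lambda_k,k)/\mu_k\to0$ and $\rho_1(\mu_k,k)\to0$; (vii) there exists $M$ such that for every $k\in\mathbb N$ there are $v_k\in\partial f_0(x_k)$ and $w_k\in\partial f_1(\mathcal P_{X_0}(x_k))$ with $\|v_k\|<M$ and $\|w_k\|\le M$. Then $$\lim_{k\to\infty}d_{X_2}(x_k)=0.$$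
   Context: $f_0,f_1:\mathbb R^n\to\mathbb R$ are convex functions, $X_0\subset\mathbb R^n$ is a nonempty closed convex set, $\|\cdot\|$ is the Euclidean norm, $\partial f$ is the convex subdifferential, $[t]_+=\max\{0,t\}$. $\{\lambda_k\}$ and $\{\mu_k\}$ are nonnegative stepsize sequences ($\mu_k>0$ so that the quotients make sense). For a nonempty closed convex set $X$, $\mathcal P_X(x)=\operatorname{argmin}_{y\in X}\|x-y\|$ and $d_X(x)=\|x-\mathcal P_X(x)\|$. For $i\in\{0,1\}$, $f_i^*$ is the optimal value of $f_i$ over $X_i$ and $X_{i+1}=\{x\in X_i: f_i(x)=f_i^*\}$. The operators $\mathcal O_{f_i}:[0,\infty)\times\mathbb R^n\to\mathbb R^n$, $i\in\{0,1\}$, come with real-valued error terms $\rho_i(\lambda,k)$, $\lambda\ge0$, $k\in\mathbb N$. Property 1: there is $\beta>0$ such that for any $\lambda\ge0$, all $k\in\mathbb N$, and all $x,y\in\mathbb R^n$ (with $x$ in the role of $x_{k+i/3}$), $$\|\mathcal O_{f_i}(\lambda,x)-y\|^2\le\|x-y\|^2-\beta\lambda\bigl(f_i(\mathcal O_{f_i}(\lambda,x))-f_i(y)\bigr)+\lambda\rho_i(\lambda,k).$$ The same $\beta$ is used for $i=0$ and $i=1$. Property 2: there exists $\gamma>0$ such that $\|x-\mathcal O_{f_i}(\lambda,x)\|\le\lambda\gamma$ for all $\lambda\ge0$ and $x\in\mathbb R^n$. *)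

theory Defs
  imports "HOL-Analysis.Analysis"
begin

definition subdifferential :: "('a::real_inner \<Rightarrow> real) \<Rightarrow> 'a \<Rightarrow> 'a set" where
  "subdifferential f x = {v. \<forall>y. f x + v \<bullet> (y - x) \<le> f y}"

text \<open>The infimum is taken in the extended reals: the real-valued \<open>Inf\<close> is an
  unspecified number on sets that are not bounded below, and \<open>optimal_set\<close> could then be
  nonempty although the minimization problem has no solution.\<close>

definition optimal_value :: "('a \<Rightarrow> real) \<Rightarrow> 'a set \<Rightarrow> ereal" where
  "optimal_value f X = (INF x\<in>X. ereal (f x))"

definition optimal_set :: "('a \<Rightarrow> real) \<Rightarrow> 'a set \<Rightarrow> 'a set" where
  "optimal_set f X = {x \<in> X. ereal (f x) = optimal_value f X}"

text \<open>The metric projection onto a nonempty closed convex set is the library's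
  \<open>closest_point\<close>.\<close>

definition proj_dist :: "'a::euclidean_space set \<Rightarrow> 'a \<Rightarrow> real" where
  "proj_dist X x = norm (x - closest_point X x)"

text \<open>The constant \<open>\<beta>\<close> is a parameter of the first property because it is
  shared by several operators.\<close>

definition Property1 ::
  "real \<Rightarrow> ('a::euclidean_space \<Rightarrow> real) \<Rightarrow> (real \<Rightarrow> 'a \<Rightarrow> 'a) \<Rightarrow> (real \<Rightarrow> nat \<Rightarrow> real) \<Rightarrow> bool" where
  "Property1 \<beta> f A \<rho> \<longleftrightarrow>
     (\<forall>t\<ge>0. \<forall>k x y.
        (norm (A t x - y))\<^sup>2
          \<le> (norm (x - y))\<^sup>2 - \<beta> * t * (f (A t x) - f y) + t * \<rho> t k)"

definition Property2 :: "(real \<Rightarrow> 'a::euclidean_space \<Rightarrow> 'a) \<Rightarrow> bool" where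
  "Property2 A \<longleftrightarrow> (\<exists>\<gamma>>0. \<forall>t\<ge>0. \<forall>x. norm (x - A t x) \<le> t * \<gamma>)"

end

theory Submission
  imports Defs
begin

text \<open>
  Let \<open>q\<^sub>k\<close> stand for the iterate after the two operator steps. Applying Property 1 twice with
  \<open>y\<close> the projection of \<open>x\<^sub>k\<close> onto \<open>X\<^sub>2\<close> gives, with \<open>\<epsilon>\<^sub>k \<longlonglongrightarrow> 0\<close> and \<open>f\<^sub>1\<^sup>*\<close> the minimum of
  \<open>f\<^sub>1\<close> over \<open>X\<^sub>1\<close>,
  \<open>d(q\<^sub>k)\<^sup>2 \<le> d(x\<^sub>k)\<^sup>2 + \<mu>\<^sub>k (\<epsilon>\<^sub>k - \<beta> (f\<^sub>1(q\<^sub>k) - f\<^sub>1\<^sup>*))\<close>, where \<open>d\<close> is the distance to \<open>X\<^sub>2\<close>.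
  The final projection onto \<open>X\<^sub>0 \<supseteq> X\<^sub>2\<close> does not increase \<open>d\<close>.

  The points \<open>q\<^sub>k\<close> approach \<open>X\<^sub>1\<close>, but may be infeasible, so \<open>f\<^sub>1(q\<^sub>k) - f\<^sub>1\<^sup>*\<close> may be negative.
  For large \<open>k\<close> this can only happen near \<open>X\<^sub>2\<close>: if \<open>d(q\<^sub>k) \<ge> \<delta>\<close>, convexity and compactness yield a
  fixed \<open>c > 0\<close> with \<open>f\<^sub>1(q\<^sub>k) - f\<^sub>1\<^sup>* \<ge> c\<close> for large \<open>k\<close> (\<open>minimizers_uniform_gap\<close>). Hence
  eventually every step either ends within \<open>\<delta>\<close> of \<open>X\<^sub>2\<close>, or decreases \<open>d\<^sup>2\<close> by at least a fixed
  multiple of \<open>\<mu>\<^sub>k\<close>. Since \<open>\<Sum> \<mu>\<^sub>k = \<infinity>\<close>, steps of the second kind cannot go on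
  forever, and once \<open>d < \<delta>\<close> neither kind of step leaves that neighbourhood
  (\<open>tendsto_zero_by_dichotomy\<close>).
\<close>

lemma mem_optimal_set_iff:
  "y \<in> optimal_set f X \<longleftrightarrow> y \<in> X \<and> (\<forall>z\<in>X. f y \<le> f z)"
proof (intro iffI conjI ballI)
  assume "y \<in> optimal_set f X"
  then have y: "y \<in> X" "ereal (f y) = (INF x\<in>X. ereal (f x))"
    by (auto simp: optimal_set_def optimal_value_def)
  then show "y \<in> X" by simp
  fix z assume "z \<in> X"
  then have "(INF x\<in>X. ereal (f x)) \<le> ereal (f z)" by (rule INF_lower)
  then show "f y \<le> f z" using y by (metis ereal_less_eq(3))
next
  assume "y \<in> X \<and> (\<forall>z\<in>X. f y \<le> f z)"
  then have "ereal (f y) = (INF x\<in>X. ereal (f x))"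
    by (intro antisym INF_greatest INF_lower) auto
  with \<open>y \<in> X \<and> _\<close> show "y \<in> optimal_set f X"
    by (auto simp: optimal_set_def optimal_value_def)
qed

lemma real_optimal_value:
  "y \<in> optimal_set f X \<Longrightarrow> real_of_ereal (optimal_value f X) = f y"
  by (auto simp: optimal_set_def dest: sym)

lemma optimal_set_eq_sublevel:
  assumes "y \<in> optimal_set f X"
  shows "optimal_set f X = X \<inter> {z. f z \<le> f y}"
  using assms unfolding mem_optimal_set_iff set_eq_iff Int_iff mem_Collect_eq
  by (blast intro: order_trans)

lemma closed_optimal_set:
  fixes f :: "'a::topological_space \<Rightarrow> real"
  assumes "continuous_on UNIV f" "closed X"
  shows "closed (optimal_set f X)"
proof (cases "optimal_set f X = {}")
  case False
  then obtain y where y: "y \<in> optimal_set f X" by auto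
  have "closed {z. f z \<le> f y}"
    using assms(1) by (intro closed_Collect_le continuous_on_const)
  then show ?thesis
    using assms(2) by (simp add: optimal_set_eq_sublevel[OF y] closed_Int)
qed simp

lemma convex_optimal_set:
  fixes f :: "'a::real_vector \<Rightarrow> real"
  assumes "convex_on UNIV f" "convex X"
  shows "convex (optimal_set f X)"
proof (cases "optimal_set f X = {}")
  case False
  then obtain y where y: "y \<in> optimal_set f X" by auto
  have "convex {z. f z \<le> f y}"
  proof (intro convexI CollectI)
    fix a b :: 'a and u v :: real
    assume *: "a \<in> {z. f z \<le> f y}" "b \<in> {z. f z \<le> f y}" "0 \<le> u" "0 \<le> v" "u + v = 1"
    have "f (u *\<^sub>R a + v *\<^sub>R b) \<le> u * f a + v * f b"
      using assms(1) * by (simp add: convex_on_def)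
    also have "\<dots> \<le> f y" using * by (intro convex_bound_le) auto
    finally show "f (u *\<^sub>R a + v *\<^sub>R b) \<le> f y" .
  qed
  then show ?thesis
    using assms(2) by (simp add: optimal_set_eq_sublevel[OF y] convex_Int)
qed simp

lemma proj_dist_eq_infdist:
  assumes "closed S" "S \<noteq> {}"
  shows "proj_dist S x = infdist x S"
  using assms by (simp add: proj_dist_def infdist_eq_setdist setdist_closest_point dist_norm)

lemma infdist_toward_member_le:
  fixes S :: "'a::euclidean_space set"
  assumes "closed S" "convex S" "y \<in> S" "0 \<le> t" "t \<le> 1"
  shows "infdist ((1 - t) *\<^sub>R y + t *\<^sub>R q) S \<le> t * infdist q S"
proof -
  have ne: "S \<noteq> {}" using assms(3) by auto
  define z where "z = closest_point S q"
  have z: "z \<in> S" using assms(1) ne by (simp add: z_def closest_point_in_set)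
  have dz: "norm (q - z) = infdist q S"
    using proj_dist_eq_infdist[OF assms(1) ne, of q] by (simp add: z_def proj_dist_def)
  have "(1 - t) *\<^sub>R y + t *\<^sub>R z \<in> S"
    using assms z by (intro convexD) auto
  then have "infdist ((1 - t) *\<^sub>R y + t *\<^sub>R q) S
      \<le> dist ((1 - t) *\<^sub>R y + t *\<^sub>R q) ((1 - t) *\<^sub>R y + t *\<^sub>R z)"
    by (rule infdist_le)
  also have "\<dots> = norm (t *\<^sub>R (q - z))"
    by (simp add: dist_norm algebra_simps)
  also have "\<dots> = t * infdist q S"
    using assms(4) dz by simp
  finally show ?thesis .
qed

text \<open>
  The projection onto \<open>C\<close> is nonexpansive and fixes the point of \<open>S\<close> nearest to \<open>q\<close>.
\<close>

lemma infdist_closest_point_le: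
  fixes C :: "'a::euclidean_space set"
  assumes "closed C" "convex C" "closed S" "S \<noteq> {}" "S \<subseteq> C"
  shows "infdist (closest_point C q) S \<le> infdist q S"
proof -
  define y where "y = closest_point S q"
  have y: "y \<in> S" using assms(3,4) by (simp add: y_def closest_point_in_set)
  have "infdist (closest_point C q) S \<le> dist (closest_point C q) y"
    using y by (rule infdist_le)
  also have "\<dots> = dist (closest_point C q) (closest_point C y)"
    using y assms(5) by (simp add: closest_point_self subset_iff)
  also have "\<dots> \<le> dist q y"
    using assms y by (intro closest_point_lipschitz) auto
  also have "\<dots> = infdist q S"
    using proj_dist_eq_infdist[OF assms(3,4), of q] by (simp add: y_def proj_dist_def dist_norm)
  finally show ?thesis .
qed

text \<open>
  On a compact set that keeps a distance \<open>\<delta>\<close> from the minimizers, a point cannot lie in \<open>X\<close> and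
  have the minimal value at the same time. So the larger of its distance from \<open>X\<close> and its excess
  value is positive there, and has a positive minimum \<open>c\<close>. A point \<open>q\<close> farther away is
  pulled along the segment towards its projection on the minimizers until it is at distance
  \<open>\<delta>\<close>. This shrinks its distance from \<open>X\<close>, and by convexity of \<open>f\<close> also its excess value, so the
  bound on the compact set carries over to \<open>q\<close>. Only the projections of the points need to be
  bounded, which covers both bounded iterates and a bounded set of minimizers.
\<close>

lemma minimizers_uniform_gap:
  fixes f :: "'a::euclidean_space \<Rightarrow> real" and X :: "'a set"
  defines "S \<equiv> optimal_set f X"
  assumes f: "convex_on UNIV f" and X: "closed X" "convex X"
    and s: "s \<in> S" and \<delta>: "\<delta> > 0"
  obtains c where "c > 0"
    "\<And>q. norm (closest_point S q) \<le> R \<Longrightarrow> infdist q X < c \<Longrightarrow> infdist q S \<ge> \<delta> \<Longrightarrow> f q \<ge> f s + c"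
proof -
  have cont: "continuous_on UNIV f" using f by (intro convex_on_continuous) auto
  have S: "closed S" "S \<noteq> {}" "S \<subseteq> X"
    using closed_optimal_set[OF cont X(1)] s by (auto simp: S_def optimal_set_def)
  have minval: "f y = f s" if "y \<in> S" for y
    using that s by (auto simp: S_def mem_optimal_set_iff intro: antisym)
  define K where "K = cball 0 (R + \<delta>) \<inter> {u. \<delta> \<le> infdist u S}"
  define g where "g = (\<lambda>u. max (infdist u X) (f u - f s))"
  have "closed {u. \<delta> \<le> infdist u S}"
    by (intro closed_Collect_le continuous_intros)
  then have K: "compact K" unfolding K_def by (intro compact_Int_closed compact_cball)
  have contg: "continuous_on K g"
    unfolding g_def by (intro continuous_intros continuous_on_subset[OF cont]) auto
  have gpos: "g u > 0" if "u \<in> K" for u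
  proof (cases "u \<in> X")
    case True
    have "u \<notin> S" using that \<delta> by (auto simp: K_def)
    then obtain z where "z \<in> X" "f z < f u"
      using True by (auto simp: S_def mem_optimal_set_iff not_le)
    then have "f s < f u" using s by (force simp: S_def mem_optimal_set_iff)
    then show ?thesis by (auto simp: g_def less_max_iff_disj)
  next
    case False
    then have "infdist u X \<noteq> 0"
      using X S by (metis in_closed_iff_infdist_zero subset_empty)
    then show ?thesis
      using infdist_nonneg[of u X] by (auto simp: g_def less_max_iff_disj)
  qed
  obtain c where c: "c > 0" "\<And>u. u \<in> K \<Longrightarrow> c \<le> g u"
  proof (cases "K = {}")
    case True
    then show ?thesis using that[of 1] by simp
  next
    case False
    then obtain u where "u \<in> K" "\<forall>v\<in>K. g u \<le> g v"
      using continuous_attains_inf[OF K _ contg] by auto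
    then show ?thesis using that[of "g u"] gpos by auto
  qed
  show thesis
  proof (rule that[OF c(1)])
    fix q
    assume q: "norm (closest_point S q) \<le> R" "infdist q X < c" "infdist q S \<ge> \<delta>"
    define y where "y = closest_point S q"
    have y: "y \<in> S" using S by (simp add: y_def closest_point_in_set)
    define D where "D = infdist q S"
    have D: "D \<ge> \<delta>" "norm (q - y) = D"
      using q proj_dist_eq_infdist[OF S(1,2), of q] by (auto simp: D_def y_def proj_dist_def)
    define t where "t = \<delta> / D"
    have t: "0 < t" "t \<le> 1" "t * D = \<delta>" using D \<delta> by (auto simp: t_def)
    define u where "u = (1 - t) *\<^sub>R y + t *\<^sub>R q"
    have "u - y = t *\<^sub>R (q - y)" by (simp add: u_def algebra_simps)
    then have uy: "norm (u - y) = \<delta>" using t D by simp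
    have "q - u = (1 - t) *\<^sub>R (q - y)" by (simp add: u_def algebra_simps)
    then have "dist q u = (1 - t) * D" using t D(2) by (simp add: dist_norm)
    then have qu: "dist q u = D - \<delta>" using t(3) by (simp add: left_diff_distrib)
    have "D \<le> infdist u S + dist q u" unfolding D_def by (rule infdist_triangle)
    moreover have "norm u \<le> norm y + norm (u - y)" by (rule norm_triangle_sub)
    ultimately have "u \<in> K" using q(1) uy qu by (simp add: K_def y_def)
    then have gu: "c \<le> g u" by (rule c)
    have "infdist u X \<le> t * infdist q X"
      unfolding u_def using t y S X by (intro infdist_toward_member_le) auto
    also have "\<dots> \<le> 1 * infdist q X" using t infdist_nonneg by (intro mult_right_mono) auto
    finally have "infdist u X < c" using q(2) by simp
    then have fu: "c \<le> f u - f s" using gu by (auto simp: g_def le_max_iff_disj)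
    have "f u \<le> (1 - t) * f y + t * f q"
      unfolding u_def using f t by (intro convex_onD) auto
    then have "c \<le> t * (f q - f s)" using fu minval[OF y] by (simp add: algebra_simps)
    moreover from this have "0 \<le> f q - f s"
      using c(1) t(1) by (smt (verit) mult_pos_neg)
    then have "t * (f q - f s) \<le> 1 * (f q - f s)" using t by (intro mult_right_mono) auto
    ultimately show "f q \<ge> f s + c" by simp
  qed
qed

text \<open>
  If no late index satisfied the first alternative for some \<open>\<delta>\<close>, then summing the second
  alternative would force the nonnegative numbers \<open>(d n)\<^sup>2\<close> below zero. After one index with
  \<open>d n < \<delta>\<close>, either alternative keeps the next one below \<open>\<delta>\<close>.
\<close>

lemma tendsto_zero_by_dichotomy:
  fixes d \<mu> :: "nat \<Rightarrow> real"
  assumes nonneg: "\<And>k. d k \<ge> 0" and \<mu>: "\<And>k. \<mu> k \<ge> 0"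
    and div: "filterlim (\<lambda>n. \<Sum>k<n. \<mu> k) at_top sequentially"
    and step: "\<And>\<delta>. \<delta> > 0 \<Longrightarrow> \<exists>a>0. \<forall>\<^sub>F k in sequentially.
                 d (Suc k) < \<delta> \<or> (d (Suc k))\<^sup>2 \<le> (d k)\<^sup>2 - a * \<mu> k"
  shows "d \<longlonglongrightarrow> 0"
proof (rule LIMSEQ_I)
  fix \<delta> :: real assume "\<delta> > 0"
  then obtain a N where a: "a > 0"
    and N: "\<And>k. k \<ge> N \<Longrightarrow> d (Suc k) < \<delta> \<or> (d (Suc k))\<^sup>2 \<le> (d k)\<^sup>2 - a * \<mu> k"
    using step unfolding eventually_sequentially by metis
  have "\<exists>k\<ge>N. d (Suc k) < \<delta>"
  proof (rule ccontr)
    assume "\<not> ?thesis"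
    with N have dec: "(d (Suc k))\<^sup>2 \<le> (d k)\<^sup>2 - a * \<mu> k" if "k \<ge> N" for k
      using that by blast
    have sum: "(d n)\<^sup>2 + a * (\<Sum>k<n. \<mu> k) \<le> (d N)\<^sup>2 + a * (\<Sum>k<N. \<mu> k)" if "n \<ge> N" for n
      using that
    proof (induction n rule: dec_induct)
      case (step n)
      then show ?case using dec[of n] by (simp add: algebra_simps)
    qed simp
    have "\<forall>\<^sub>F n in sequentially. (\<Sum>k<n. \<mu> k) > ((d N)\<^sup>2 + a * (\<Sum>k<N. \<mu> k)) / a"
      using div by (simp add: filterlim_at_top_dense)
    then obtain n where n: "n \<ge> N" "(\<Sum>k<n. \<mu> k) > ((d N)\<^sup>2 + a * (\<Sum>k<N. \<mu> k)) / a"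
      unfolding eventually_sequentially by (metis nat_le_linear order_refl)
    then have "a * (\<Sum>k<n. \<mu> k) > (d N)\<^sup>2 + a * (\<Sum>k<N. \<mu> k)"
      using a by (simp add: pos_divide_less_eq mult.commute)
    with sum[OF n(1)] show False using zero_le_power2[of "d n"] by linarith
  qed
  then obtain k where k: "k \<ge> N" "d (Suc k) < \<delta>" by auto
  have "d n < \<delta>" if "n \<ge> Suc k" for n
    using that
  proof (induction n rule: dec_induct)
    case (step n)
    have "d (Suc n) < \<delta> \<or> (d (Suc n))\<^sup>2 \<le> (d n)\<^sup>2"
      using N[of n] step k(1) a mult_nonneg_nonneg[of a "\<mu> n"] \<mu>[of n] by fastforce
    then show ?case
      using step nonneg power2_le_imp_le[of "d (Suc n)" "d n"] by force
  qed (rule k)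
  then show "\<exists>no. \<forall>n\<ge>no. norm (d n - 0) < \<delta>"
    using nonneg by auto
qed

theorem proposition3:
  fixes f0 f1 :: "real ^ 'n \<Rightarrow> real"
    and X0 X1 X2 :: "(real ^ 'n) set"
    and Op0 Op1 :: "real \<Rightarrow> real ^ 'n \<Rightarrow> real ^ 'n"
    and \<rho>0 \<rho>1 :: "real \<Rightarrow> nat \<Rightarrow> real"
    and lam \<mu> :: "nat \<Rightarrow> real"
    and x x_third x_two_thirds :: "nat \<Rightarrow> real ^ 'n"
  assumes "convex_on UNIV f0" and "convex_on UNIV f1"
    and "X0 \<noteq> {}" and "closed X0" and "convex X0"
    and "X1 = optimal_set f0 X0" and "X2 = optimal_set f1 X1"
    and "\<And>k. lam k \<ge> 0" and "\<And>k. \<mu> k > 0"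
    and "\<And>k. x_third k = Op0 (lam k) (x k)"
    and "\<And>k. x_two_thirds k = Op1 (\<mu> k) (x_third k)"
    and "\<And>k. x (Suc k) = closest_point X0 (x_two_thirds k)"
    and "X2 \<noteq> {}" and "bounded X2 \<or> bounded (range x)"
    and "\<mu> \<longlonglongrightarrow> 0" and "filterlim (\<lambda>n. \<Sum>k<n. \<mu> k) at_top sequentially"
    and "\<exists>\<beta>>0. Property1 \<beta> f0 Op0 \<rho>0 \<and> Property1 \<beta> f1 Op1 \<rho>1"
    and "Property2 Op1"
    and "(\<lambda>k. lam k * max 0 (real_of_ereal (optimal_value f0 X0) - f0 (x_third k)) / \<mu> k) \<longlonglongrightarrow> 0"
    and "(\<lambda>k. proj_dist X1 (x k)) \<longlonglongrightarrow> 0"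
    and "(\<lambda>k. norm (x k - x_third k)) \<longlonglongrightarrow> 0"
    and "(\<lambda>k. lam k * \<rho>0 (lam k) k / \<mu> k) \<longlonglongrightarrow> 0"
    and "(\<lambda>k. \<rho>1 (\<mu> k) k) \<longlonglongrightarrow> 0"
    and "\<exists>M. \<forall>k. \<exists>v\<in>subdifferential f0 (x k). \<exists>w\<in>subdifferential f1 (closest_point X0 (x k)).
           norm v < M \<and> norm w \<le> M"
  shows "(\<lambda>k. proj_dist X2 (x k)) \<longlonglongrightarrow> 0"
proof -
  note f = assms(1,2) and X0 = assms(3-5) and X1_def = assms(6) and X2_def = assms(7)
    and lam = assms(8) and \<mu> = assms(9) and x_third = assms(10) and x_two_thirds = assms(11)
    and x_Suc = assms(12)
  define q where "q = x_two_thirds"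
  obtain \<beta> where \<beta>: "\<beta> > 0" and P0: "Property1 \<beta> f0 Op0 \<rho>0" and P1: "Property1 \<beta> f1 Op1 \<rho>1"
    using assms(17) by auto
  obtain \<gamma> where \<gamma>: "\<And>t z. t \<ge> 0 \<Longrightarrow> norm (z - Op1 t z) \<le> t * \<gamma>"
    using assms(18) unfolding Property2_def by blast
  obtain s where s: "s \<in> X2" using assms(13) by auto
  have sub: "X2 \<subseteq> X1" "X1 \<subseteq> X0"
    unfolding X1_def X2_def by (auto simp: mem_optimal_set_iff)
  have "continuous_on UNIV f0" "continuous_on UNIV f1"
    using f by (auto intro: convex_on_continuous)
  then have closed: "closed X1" "closed X2"
    unfolding X1_def X2_def using X0 by (auto intro: closed_optimal_set)
  have convex: "convex X1" "convex X2"
    unfolding X1_def X2_def using X0 f by (auto intro: convex_optimal_set)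
  have ne: "X1 \<noteq> {}" "X2 \<noteq> {}" using s sub by auto
  define d where "d = (\<lambda>z. infdist z X2)"

  have xq: "(\<lambda>k. norm (x k - q k)) \<longlonglongrightarrow> 0"
  proof (rule tendsto_sandwich[OF _ _ tendsto_const])
    have "(\<lambda>k. norm (x k - x_third k) + \<mu> k * \<gamma>) \<longlonglongrightarrow> 0 + 0 * \<gamma>"
      using assms(15,21) by (intro tendsto_intros)
    then show "(\<lambda>k. norm (x k - x_third k) + \<mu> k * \<gamma>) \<longlonglongrightarrow> 0" by simp
    have "norm (x k - q k) \<le> norm (x k - x_third k) + \<mu> k * \<gamma>" for k
      using norm_triangle_ineq[of "x k - x_third k" "x_third k - q k"]
        \<gamma>[of "\<mu> k" "x_third k"] \<mu>[of k] by (simp add: q_def x_two_thirds)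
    then show "\<forall>\<^sub>F k in sequentially. norm (x k - q k) \<le> norm (x k - x_third k) + \<mu> k * \<gamma>"
      by (intro always_eventually allI)
  qed simp
  have qX1: "(\<lambda>k. infdist (q k) X1) \<longlonglongrightarrow> 0"
  proof (rule tendsto_sandwich[OF _ _ tendsto_const])
    have "(\<lambda>k. infdist (x k) X1 + norm (x k - q k)) \<longlonglongrightarrow> 0 + 0"
      using assms(20) xq unfolding proj_dist_eq_infdist[OF closed(1) ne(1)]
      by (intro tendsto_intros)
    then show "(\<lambda>k. infdist (x k) X1 + norm (x k - q k)) \<longlonglongrightarrow> 0" by simp
    show "\<forall>\<^sub>F k in sequentially. infdist (q k) X1 \<le> infdist (x k) X1 + norm (x k - q k)"
      using infdist_triangle[of "q _" X1 "x _"]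
      by (intro always_eventually allI) (simp add: dist_norm norm_minus_commute)
  qed (simp add: infdist_nonneg)

  have "bounded (range (\<lambda>k. closest_point X2 (q k)))"
    using assms(14)
  proof
    assume "bounded X2"
    then show ?thesis
      by (rule bounded_subset) (use closed ne in \<open>auto intro: closest_point_in_set\<close>)
  next
    assume "bounded (range x)"
    moreover have "bounded (range (\<lambda>k. x k - q k))"
      using xq by (intro convergent_imp_bounded[of _ 0]) (simp add: tendsto_norm_zero_iff)
    ultimately have "bounded (range (\<lambda>k. x k - (x k - q k)))"
      by (rule bounded_minus_comp)
    then obtain B where B: "\<And>k. dist s (q k) \<le> B"
      by (auto simp: bounded_any_center[of _ s])
    have "dist s (closest_point X2 (q k)) \<le> B" for k
      using closest_point_lipschitz[OF convex(2) closed(2) ne(2), of s "q k"] B[of k] s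
      by (simp add: closest_point_self)
    then show ?thesis by (auto simp: bounded_def)
  qed
  then obtain R where R: "\<And>k. norm (closest_point X2 (q k)) \<le> R"
    by (auto simp: bounded_iff)

  define f0opt where "f0opt = real_of_ereal (optimal_value f0 X0)"
  \<comment> \<open>The first summand pays for a possibly infeasible \<open>x_third k\<close>, at which \<open>f0\<close> may lie below
    its optimal value; the quotients have the factor \<open>\<mu> k\<close> of the descent estimate taken out.\<close>
  define \<epsilon> where "\<epsilon> = (\<lambda>k. \<beta> * (lam k * max 0 (f0opt - f0 (x_third k)) / \<mu> k)
    + lam k * \<rho>0 (lam k) k / \<mu> k + \<rho>1 (\<mu> k) k)"
  have "\<epsilon> \<longlonglongrightarrow> \<beta> * 0 + 0 + 0"
    unfolding \<epsilon>_def f0opt_def using assms(19,22,23) by (intro tendsto_intros)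
  then have \<epsilon>: "\<epsilon> \<longlonglongrightarrow> 0" by simp

  have descent: "(d (x (Suc k)))\<^sup>2 \<le> (d (x k))\<^sup>2 + \<mu> k * (\<epsilon> k - \<beta> * (f1 (q k) - f1 s))" for k
  proof -
    define y where "y = closest_point X2 (x k)"
    have y: "y \<in> X2" using closed ne by (simp add: y_def closest_point_in_set)
    have f0y: "f0 y = f0opt"
      using y sub by (auto simp: f0opt_def X1_def real_optimal_value)
    have f1y: "f1 y = f1 s"
      using y s by (auto simp: X2_def mem_optimal_set_iff intro: antisym)
    have "d (x (Suc k)) \<le> d (q k)"
      unfolding d_def x_Suc q_def using X0 closed ne sub by (intro infdist_closest_point_le) auto
    also have "\<dots> \<le> norm (q k - y)"
      unfolding d_def dist_norm[symmetric] using y by (rule infdist_le)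
    finally have "(d (x (Suc k)))\<^sup>2 \<le> (norm (q k - y))\<^sup>2"
      by (intro power_mono) (simp_all add: d_def infdist_nonneg)
    also have "\<dots> \<le> (norm (x_third k - y))\<^sup>2 - \<beta> * \<mu> k * (f1 (q k) - f1 s) + \<mu> k * \<rho>1 (\<mu> k) k"
      using P1 \<mu>[of k] by (simp add: Property1_def q_def x_two_thirds less_imp_le flip: f1y)
    finally have step1: "(d (x (Suc k)))\<^sup>2
        \<le> (norm (x_third k - y))\<^sup>2 - \<beta> * \<mu> k * (f1 (q k) - f1 s) + \<mu> k * \<rho>1 (\<mu> k) k" .
    have "norm (x k - y) = d (x k)"
      using proj_dist_eq_infdist[OF closed(2) ne(2), of "x k"] by (simp add: d_def y_def proj_dist_def)
    then have step0: "(norm (x_third k - y))\<^sup>2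
        \<le> (d (x k))\<^sup>2 - \<beta> * lam k * (f0 (x_third k) - f0opt) + lam k * \<rho>0 (lam k) k"
      using P0 lam[of k] unfolding Property1_def x_third f0y[symmetric] by metis
    have "\<beta> * lam k * (f0opt - f0 (x_third k)) \<le> \<beta> * lam k * max 0 (f0opt - f0 (x_third k))"
      using \<beta> lam[of k] by (intro mult_left_mono) auto
    moreover have "\<mu> k * \<epsilon> k = \<beta> * lam k * max 0 (f0opt - f0 (x_third k))
        + lam k * \<rho>0 (lam k) k + \<mu> k * \<rho>1 (\<mu> k) k"
      using \<mu>[of k] by (simp add: \<epsilon>_def distrib_left)
    ultimately show ?thesis
      using step0 step1 by (simp add: algebra_simps)
  qed

  have "(\<lambda>k. d (x k)) \<longlonglongrightarrow> 0"
  proof (rule tendsto_zero_by_dichotomy[OF _ _ assms(16)])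
    fix \<delta> :: real assume "\<delta> > 0"
    then obtain c where c: "c > 0" and gap: "\<And>q. norm (closest_point X2 q) \<le> R \<Longrightarrow>
        infdist q X1 < c \<Longrightarrow> d q \<ge> \<delta> \<Longrightarrow> f1 q \<ge> f1 s + c"
      using minimizers_uniform_gap[OF f(2) closed(1) convex(1)] s unfolding X2_def d_def by metis
    \<comment> \<open>Half of the gap \<open>\<beta> * c\<close> absorbs the errors \<open>\<epsilon>\<close>.\<close>
    have "\<beta> * c / 2 > 0" using \<beta> c by simp
    moreover have "\<forall>\<^sub>F k in sequentially.
        d (x (Suc k)) < \<delta> \<or> (d (x (Suc k)))\<^sup>2 \<le> (d (x k))\<^sup>2 - \<beta> * c / 2 * \<mu> k"
      using order_tendstoD(2)[OF qX1 c] order_tendstoD(2)[OF \<epsilon> \<open>\<beta> * c / 2 > 0\<close>]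
    proof eventually_elim
      case (elim k)
      show ?case
      proof (cases "d (q k) < \<delta>")
        case True
        have "d (x (Suc k)) \<le> d (q k)"
          unfolding d_def x_Suc q_def using X0 closed ne sub by (intro infdist_closest_point_le) auto
        then show ?thesis using True by simp
      next
        case False
        then have "c \<le> f1 (q k) - f1 s" using gap[OF R elim(1)] by simp
        then have "\<beta> * c \<le> \<beta> * (f1 (q k) - f1 s)" using \<beta> by simp
        then have "\<epsilon> k - \<beta> * (f1 (q k) - f1 s) \<le> - (\<beta> * c / 2)" using elim(2) by linarith
        then have "\<mu> k * (\<epsilon> k - \<beta> * (f1 (q k) - f1 s)) \<le> \<mu> k * - (\<beta> * c / 2)"
          using \<mu>[of k] by (intro mult_left_mono) auto
        then show ?thesis using descent[of k] by (simp add: mult.commute)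
      qed
    qed
    ultimately show "\<exists>a>0. \<forall>\<^sub>F k in sequentially.
        d (x (Suc k)) < \<delta> \<or> (d (x (Suc k)))\<^sup>2 \<le> (d (x k))\<^sup>2 - a * \<mu> k"
      by blast
  qed (use \<mu> in \<open>auto simp: d_def infdist_nonneg less_imp_le\<close>)
  then show ?thesis
    by (simp add: d_def proj_dist_eq_infdist[OF closed(2) ne(2)])
qed

end
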